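(* Let $r\ge1$ and $k\ge2$ be integers and $n=kr$. Consider the following randomized procedure: choose permutations $\sigma=\sigma_1\cdots\sigma_n$ and $\tau=\tau_1\cdots\tau_n$ of $\{1,\dots,n\}$ independently and uniformly at random from $S_n$, and define $f:\{1,\dots,n\}\to\{1,\dots,n\}$ by $f(\tau_{ik+j})=\sigma_{i+1}$ for $i=0,\dots,r-1$ and $j=1,\dots,k$. Then $f$ is a uniformly random $\{0,k\}$-mapping on $n$ nodes, i.e., every $\{0,k\}$-mapping on $\{1,\dots,n\}$ is output with the same probability.
   Context: A $\{0,k\}$-mapping on $n$ nodes is a function $f:\{1,\dots,n\}\to\{1,\dots,n\}$ with $|f^{-1}(y)|\in\{0,k\}$ for every $y$. *)

theory Defs
  imports "HOL-Probability.Probability" "HOL-Combinatorics.Combinatorics"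
begin

text \<open>
  A mapping on n nodes is a self-map of \<open>{1..n}\<close>. It is represented by an extensional
  function, so that distinct HOL functions are distinct mappings.
\<close>

definition zero_k_mappings :: "nat \<Rightarrow> nat \<Rightarrow> (nat \<Rightarrow> nat) set" where
  "zero_k_mappings k n =
     {f \<in> {1..n} \<rightarrow>\<^sub>E {1..n}. \<forall>y\<in>{1..n}. card {x \<in> {1..n}. f x = y} \<in> {0, k}}"

definition mapping_of_perms ::
    "nat \<Rightarrow> nat \<Rightarrow> nat \<Rightarrow> (nat \<Rightarrow> nat) \<Rightarrow> (nat \<Rightarrow> nat) \<Rightarrow> nat \<Rightarrow> nat" where
  "mapping_of_perms k r n \<sigma> \<tau> =
     (THE f. f \<in> {1..n} \<rightarrow>\<^sub>E {1..n} \<and>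
             (\<forall>i<r. \<forall>j\<in>{1..k}. f (\<tau> (i * k + j)) = \<sigma> (i + 1)))"

definition random_mapping :: "nat \<Rightarrow> nat \<Rightarrow> nat \<Rightarrow> (nat \<Rightarrow> nat) pmf" where
  "random_mapping k r n =
     map_pmf (\<lambda>(\<sigma>, \<tau>). mapping_of_perms k r n \<sigma> \<tau>)
       (pair_pmf (pmf_of_set {\<sigma>. \<sigma> permutes {1..n}}) (pmf_of_set {\<tau>. \<tau> permutes {1..n}}))"

text \<open>
  The description inside \<^const>\<open>mapping_of_perms\<close> is proper: the equations determine a
  unique mapping.
\<close>

lemma mapping_of_perms_ex1:
  fixes k r n :: nat
  assumes k: "k \<ge> 2" and n: "n = k * r"
    and s: "\<sigma> permutes {1..n}" and t: "\<tau> permutes {1..n}"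
  shows "\<exists>!f. f \<in> {1..n} \<rightarrow>\<^sub>E {1..n} \<and>
              (\<forall>i<r. \<forall>j\<in>{1..k}. f (\<tau> (i * k + j)) = \<sigma> (i + 1))"
proof (rule ex_ex1I)
  have pos: "i * k + j \<in> {1..n}" if "i < r" "j \<in> {1..k}" for i j
  proof -
    have "Suc i * k \<le> r * k" using that by (intro mult_right_mono) auto
    then show ?thesis using that by (auto simp: n mult.commute)
  qed
  have dec: "\<exists>i<r. \<exists>j\<in>{1..k}. m = i * k + j" if "m \<in> {1..n}" for m
  proof (intro exI conjI bexI)
    show "(m - 1) div k < r"
      using that k by (auto simp: n less_mult_imp_div_less mult.commute)
    show "m = (m - 1) div k * k + ((m - 1) mod k + 1)"
      using that div_mult_mod_eq[of "m - 1" k] by auto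
    show "(m - 1) mod k + 1 \<in> {1..k}"
      using k by (auto simp: Suc_leI)
  qed
  have rn: "i + 1 \<in> {1..n}" if "i < r" for i
  proof -
    have "1 * r \<le> k * r" using k by (intro mult_right_mono) auto
    then have "r \<le> n" by (simp only: n mult_1)
    then show ?thesis using that by auto
  qed
  define f where "f = restrict (\<lambda>x. \<sigma> ((inv \<tau> x - 1) div k + 1)) {1..n}"
  show "\<exists>f. f \<in> {1..n} \<rightarrow>\<^sub>E {1..n} \<and>
            (\<forall>i<r. \<forall>j\<in>{1..k}. f (\<tau> (i * k + j)) = \<sigma> (i + 1))"
  proof (intro exI[of _ f] conjI allI impI ballI)
    have "f x \<in> {1..n}" if x: "x \<in> {1..n}" for x
    proof -
      have "inv \<tau> x \<in> {1..n}" using permutes_in_image[OF permutes_inv[OF t]] x by blast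
      then have "(inv \<tau> x - 1) div k < r"
        using k by (auto simp: n less_mult_imp_div_less mult.commute)
      from rn[OF this] show ?thesis
        using x permutes_in_image[OF s] unfolding f_def by auto
    qed
    then show "f \<in> {1..n} \<rightarrow>\<^sub>E {1..n}" by (auto simp: f_def)
    fix i j assume ij: "i < r" "j \<in> {1..k}"
    have "\<tau> (i * k + j) \<in> {1..n}" using pos[OF ij] permutes_in_image[OF t] by blast
    moreover have "(i * k + j - 1) div k = i"
      using ij k by (intro div_nat_eqI) (auto simp: mult.commute)
    ultimately show "f (\<tau> (i * k + j)) = \<sigma> (i + 1)"
      by (simp add: f_def permutes_inverses(2)[OF t])
  qed
  fix f g
  assume f: "f \<in> {1..n} \<rightarrow>\<^sub>E {1..n} \<and> (\<forall>i<r. \<forall>j\<in>{1..k}. f (\<tau> (i * k + j)) = \<sigma> (i + 1))"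
    and g: "g \<in> {1..n} \<rightarrow>\<^sub>E {1..n} \<and> (\<forall>i<r. \<forall>j\<in>{1..k}. g (\<tau> (i * k + j)) = \<sigma> (i + 1))"
  show "f = g"
  proof (rule PiE_ext[of f "{1..n}" "\<lambda>_. {1..n}" g])
    fix x assume x: "x \<in> {1..n}"
    have "inv \<tau> x \<in> {1..n}" using permutes_in_image[OF permutes_inv[OF t]] x by blast
    from dec[OF this] obtain i j where ij: "i < r" "j \<in> {1..k}" "inv \<tau> x = i * k + j" by blast
    have "x = \<tau> (i * k + j)" using ij(3) permutes_inverses(1)[OF t] by metis
    then show "f x = g x" using f g ij by simp
  qed (use f g in auto)
qed

text \<open>
  The operator \<^const>\<open>pmf_of_set\<close> is unspecified on empty and on infinite sets; neither
  case occurs here.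
\<close>

lemma finite_zero_k_mappings: "finite (zero_k_mappings k n)"
  by (rule finite_subset[of _ "{1..n} \<rightarrow>\<^sub>E {1..n}"])
     (auto simp: zero_k_mappings_def intro!: finite_PiE)

lemma zero_k_mappings_nonempty:
  fixes k r n :: nat
  assumes k: "k \<ge> 2" and n: "n = k * r"
  shows "zero_k_mappings k n \<noteq> {}"
proof -
  define f where "f = restrict (\<lambda>x. (x - 1) div k + 1) {1..n}"
  have *: "f x = y \<longleftrightarrow> (y - 1) * k < x \<and> x \<le> y * k"
    if "x \<in> {1..n}" "y \<in> {1..n}" for x y
  proof -
    from that obtain a b where ab: "x = Suc a" "y = Suc b"
      by (cases x; cases y) auto
    have "b \<le> a div k \<longleftrightarrow> b * k \<le> a" "a div k < Suc b \<longleftrightarrow> a < Suc b * k"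
      using k less_eq_div_iff_mult_less_eq[of k b a] div_less_iff_less_mult[of k a "Suc b"]
      by linarith+
    then have "a div k = b \<longleftrightarrow> b * k \<le> a \<and> a < Suc b * k" by linarith
    then have "a div k = b \<longleftrightarrow> b * k < Suc a \<and> Suc a \<le> Suc b * k"
      by (simp only: Suc_le_eq less_Suc_eq_le)
    moreover have "f x = Suc (a div k)" using that by (simp add: f_def ab)
    ultimately show ?thesis by (simp add: ab)
  qed
  have "card {x \<in> {1..n}. f x = y} \<in> {0, k}" if y: "y \<in> {1..n}" for y
  proof (cases "y \<le> r")
    case True
    have "y * k \<le> n" using True by (simp add: n mult.commute)
    then have "x \<in> {1..n} \<and> f x = y \<longleftrightarrow> x \<in> {(y - 1) * k<..y * k}" for x
      using *[of x y] y by (cases "x \<in> {1..n}") auto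
    then have "{x \<in> {1..n}. f x = y} = {(y - 1) * k<..y * k}"
      by blast
    moreover have "y * k - (y - 1) * k = k" using y by (simp add: diff_mult_distrib[symmetric])
    ultimately show ?thesis by simp
  next
    case False
    then have "r \<le> y - 1" by auto
    then have "n \<le> (y - 1) * k" by (simp add: n mult.commute)
    then have "\<not> (x \<in> {1..n} \<and> f x = y)" for x
      using *[of x y] y by (cases "x \<in> {1..n}") auto
    then have "{x \<in> {1..n}. f x = y} = {}" by blast
    then show ?thesis by simp
  qed
  moreover have "f x \<in> {1..n}" if "x \<in> {1..n}" for x
  proof -
    have "(x - 1) div k \<le> x - 1" by (rule div_le_dividend)
    then have "(x - 1) div k + 1 \<in> {1..n}" using that unfolding atLeastAtMost_iff by linarith
    then show ?thesis using that by (simp add: f_def)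
  qed
  ultimately have "f \<in> zero_k_mappings k n"
    by (auto simp: zero_k_mappings_def f_def)
  then show ?thesis by blast
qed

end

theory Submission
  imports Defs
begin

text \<open>
  Pairs of permutations act on mappings by relabelling values and arguments,
  \<open>f \<mapsto> a \<circ> f \<circ> p\<close>. On the procedure's output this amounts to replacing \<open>\<sigma>\<close> by
  \<open>a \<circ> \<sigma>\<close> and \<open>\<tau>\<close> by \<open>p\<^sup>-\<^sup>1 \<circ> \<tau>\<close>, which preserves the uniform distribution of
  \<open>(\<sigma>, \<tau>)\<close>; hence the output distribution is invariant under the action. Two
  \<open>{0,k}\<close>-mappings have images of the same size \<open>r\<close> and all nonempty fibres of size \<open>k\<close>,
  so the action is transitive on them, and an invariant distribution is uniform.
\<close>

section \<open>Relabelling and the permutations it requires\<close>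

text \<open>Restricting to \<open>A\<close> keeps the result extensional: outside \<open>A\<close>
  the bare composition takes the value \<open>a undefined\<close>, which may differ from
  \<open>undefined\<close>.\<close>

definition relabel :: "'a set \<Rightarrow> ('a \<Rightarrow> 'b) \<Rightarrow> ('a \<Rightarrow> 'a) \<Rightarrow> ('a \<Rightarrow> 'a) \<Rightarrow> 'a \<Rightarrow> 'b" where
  "relabel A a p f = restrict (a \<circ> f \<circ> p) A"

text \<open>Since \<open>p\<close> maps \<open>A\<close> onto itself, a relabelled map still reveals
  every value \<open>a (f x)\<close>. Injectivity is what lets point probabilities be carried along
  an orbit.\<close>

lemma relabel_inj_on:
  assumes "inj a" "p permutes A"
  shows "inj_on (relabel A a p) (A \<rightarrow>\<^sub>E B)"
proof (rule inj_onI)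
  fix f g assume f: "f \<in> A \<rightarrow>\<^sub>E B" and g: "g \<in> A \<rightarrow>\<^sub>E B"
    and eq: "relabel A a p f = relabel A a p g"
  show "f = g"
  proof (rule PiE_ext[OF f g])
    fix x assume "x \<in> A"
    then obtain z where z: "z \<in> A" "x = p z"
      using permutes_image[OF assms(2)] by blast
    then have "a (f (p z)) = a (g (p z))"
      using fun_cong[OF eq, of z] by (simp add: relabel_def)
    then show "f x = g x" using \<open>inj a\<close> z by (simp add: inj_eq)
  qed
qed

text \<open>Fibre sizes are the multiplicities in the multiset of values over \<open>A\<close>, and
  two families with the same multiset of values differ by a permutation of their indices.\<close>

lemma ex_permutes_eq_comp:
  assumes "finite A"
    and card_eq: "\<And>y. card {x \<in> A. f x = y} = card {x \<in> A. g x = y}"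
  obtains p where "p permutes A" and "\<And>x. x \<in> A \<Longrightarrow> f x = g (p x)"
proof -
  have "count (image_mset h (mset_set A)) y = card {x \<in> A. h x = y}" for h :: "'a \<Rightarrow> 'b" and y
  proof -
    have "h -` {y} \<inter> A = {x \<in> A. h x = y}" by auto
    then show ?thesis using assms(1) by (simp add: count_image_mset)
  qed
  then have "image_mset f (mset_set A) = image_mset g (mset_set A)"
    by (intro multiset_eqI) (simp add: card_eq)
  then obtain p where "p permutes A" "\<forall>x\<in>A. f x = g (p x)"
    by (rule image_mset_eq_implies_permutes[OF assms(1)])
  then show ?thesis by (intro that) simp_all
qed

text \<open>This is \<open>ex_permutes_eq_comp\<close> for the Boolean indicator functions of
  \<open>B\<close> and \<open>C\<close>, whose fibres are the sets and their complements in
  \<open>A\<close>.\<close>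

lemma ex_permutes_mem_iff:
  assumes "finite A" "B \<subseteq> A" "C \<subseteq> A" "card B = card C"
  obtains p where "p permutes A" and "\<And>x. x \<in> A \<Longrightarrow> x \<in> B \<longleftrightarrow> p x \<in> C"
proof -
  have eq: "card {x \<in> A. (x \<in> D) = b} = (if b then card D else card A - card D)"
    if "D \<subseteq> A" for D b
  proof -
    have "{x \<in> A. (x \<in> D) = b} = (if b then D else A - D)" using that by auto
    then show ?thesis
      using that finite_subset[OF that assms(1)] by (simp add: card_Diff_subset)
  qed
  have "card {x \<in> A. (x \<in> B) = b} = card {x \<in> A. (x \<in> C) = b}" for b
    using assms by (simp add: eq)
  then obtain p where "p permutes A" "\<And>x. x \<in> A \<Longrightarrow> (x \<in> B) = (p x \<in> C)"
    by (rule ex_permutes_eq_comp[OF assms(1)]) blast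
  then show ?thesis by (rule that)
qed

lemma card_fibre_comp_permutes:
  assumes "a permutes A"
  shows "card {x \<in> B. a (f x) = y} = card {x \<in> B. f x = inv a y}"
proof -
  have "a z = y \<longleftrightarrow> z = inv a y" for z
    using permutes_inv_eq[OF assms, of y z] by auto
  then show ?thesis by simp
qed

section \<open>Transitivity on the mappings with fibre sizes 0 and \<open>k\<close>\<close>

lemma zero_k_mappings_PiE: "f \<in> zero_k_mappings k n \<Longrightarrow> f \<in> {1..n} \<rightarrow>\<^sub>E {1..n}"
  by (simp add: zero_k_mappings_def)

lemma card_fibre_zero_k_mapping:
  assumes "f \<in> zero_k_mappings k n"
  shows "card {x \<in> {1..n}. f x = y} = (if y \<in> f ` {1..n} then k else 0)"
proof (cases "y \<in> f ` {1..n}")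
  case True
  then have "y \<in> {1..n}" using zero_k_mappings_PiE[OF assms] by auto
  then have "card {x \<in> {1..n}. f x = y} \<in> {0, k}"
    using assms by (simp add: zero_k_mappings_def)
  moreover have "{x \<in> {1..n}. f x = y} \<noteq> {}" using True by blast
  then have "card {x \<in> {1..n}. f x = y} \<noteq> 0" by (subst card_eq_0_iff) auto
  ultimately have "card {x \<in> {1..n}. f x = y} = k" by blast
  then show ?thesis by (simp only: if_P[OF True])
next
  case False
  then have "{x \<in> {1..n}. f x = y} = {}" by blast
  then show ?thesis using False by simp
qed

text \<open>Double counting: the domain is the disjoint union of the fibres over the image, each of
  size \<open>k\<close>.\<close>

lemma card_image_zero_k_mapping:
  assumes "f \<in> zero_k_mappings k n"
  shows "k * card (f ` {1..n}) = n"
proof -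
  have "n = (\<Sum>x\<in>{1..n}. 1)" by simp
  also have "\<dots> = (\<Sum>y\<in>f ` {1..n}. \<Sum>x | x \<in> {1..n} \<and> f x = y. 1)"
    by (rule sum.image_gen) simp
  also have "\<dots> = (\<Sum>y\<in>f ` {1..n}. k)"
    by (intro sum.cong refl) (simp add: card_fibre_zero_k_mapping[OF assms, simplified])
  finally show ?thesis by (simp add: mult.commute)
qed

text \<open>First \<open>a\<close> is chosen to carry the image of \<open>f\<close> onto that of
  \<open>g\<close>, which has the same size. Then \<open>a \<circ> f\<close> and \<open>g\<close>
  have equal fibre sizes everywhere, so a permutation \<open>p\<close> of the arguments matches
  them.\<close>

lemma zero_k_mappings_transitive:
  assumes "k > 0" and f: "f \<in> zero_k_mappings k n" and g: "g \<in> zero_k_mappings k n"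
  obtains a p where "a permutes {1..n}" "p permutes {1..n}" "g = relabel {1..n} a p f"
proof -
  let ?A = "{1..n}"
  have "k * card (f ` ?A) = k * card (g ` ?A)"
    using card_image_zero_k_mapping[OF f] card_image_zero_k_mapping[OF g] by simp
  then have "card (f ` ?A) = card (g ` ?A)" using \<open>k > 0\<close> by simp
  moreover have sub: "f ` ?A \<subseteq> ?A" "g ` ?A \<subseteq> ?A"
    using zero_k_mappings_PiE[OF f] zero_k_mappings_PiE[OF g] by auto
  ultimately obtain a where a: "a permutes ?A"
    and im: "\<And>x. x \<in> ?A \<Longrightarrow> x \<in> f ` ?A \<longleftrightarrow> a x \<in> g ` ?A"
    using ex_permutes_mem_iff[of ?A "f ` ?A" "g ` ?A"] by blast
  have "card {x \<in> ?A. g x = y} = card {x \<in> ?A. (a \<circ> f) x = y}" for y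
  proof -
    have "inv a y \<in> f ` ?A \<longleftrightarrow> y \<in> g ` ?A"
    proof (cases "y \<in> ?A")
      case True
      then have "inv a y \<in> ?A" using permutes_in_image[OF permutes_inv[OF a]] by blast
      then show ?thesis using im[of "inv a y"] permutes_inverses(1)[OF a] by simp
    next
      \<comment> \<open>Outside the node set \<open>a\<close> fixes \<open>y\<close>, and neither
        image contains it.\<close>
      case False
      then have "inv a y = y" using permutes_not_in[OF permutes_inv[OF a]] by blast
      then show ?thesis using False sub by auto
    qed
    then show ?thesis
      unfolding comp_apply card_fibre_comp_permutes[OF a]
        card_fibre_zero_k_mapping[OF f] card_fibre_zero_k_mapping[OF g] by simp
  qed
  then obtain p where p: "p permutes ?A" "\<And>x. x \<in> ?A \<Longrightarrow> g x = (a \<circ> f) (p x)"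
    using ex_permutes_eq_comp[of ?A g "a \<circ> f"] by blast
  have "g = relabel ?A a p f"
  proof (rule ext)
    show "g x = relabel ?A a p f x" for x
      using p(2)[of x] PiE_arb[OF zero_k_mappings_PiE[OF g], of x]
      by (cases "x \<in> ?A") (simp_all add: relabel_def)
  qed
  with a p(1) show ?thesis using that by blast
qed

section \<open>The output for fixed permutations\<close>

text \<open>The node \<open>x\<close> stands at position \<open>inv \<tau> x\<close>. Positions and
  values of \<open>\<sigma>\<close> count from 1 but blocks of length \<open>k\<close> count from 0,
  hence the shifts by one around \<open>div\<close>.\<close>

lemma mapping_of_perms_eq:
  assumes "k \<ge> 2" "n = k * r" "\<sigma> permutes {1..n}" "\<tau> permutes {1..n}"
  shows "mapping_of_perms k r n \<sigma> \<tau> = restrict (\<lambda>x. \<sigma> ((inv \<tau> x - 1) div k + 1)) {1..n}"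
proof -
  let ?f = "mapping_of_perms k r n \<sigma> \<tau>"
  have f: "?f \<in> {1..n} \<rightarrow>\<^sub>E {1..n} \<and> (\<forall>i<r. \<forall>j\<in>{1..k}. ?f (\<tau> (i * k + j)) = \<sigma> (i + 1))"
    unfolding mapping_of_perms_def by (rule theI'[OF mapping_of_perms_ex1[OF assms]])
  have "?f x = \<sigma> ((inv \<tau> x - 1) div k + 1)" if "x \<in> {1..n}" for x
  proof -
    define m where "m = inv \<tau> x - 1"
    have "inv \<tau> x \<in> {1..n}"
      using permutes_in_image[OF permutes_inv[OF assms(4)]] that by blast
    then have m: "m < n" "inv \<tau> x = m + 1" by (auto simp: m_def)
    have "m div k < r" using m by (simp add: assms(2) less_mult_imp_div_less mult.commute)
    moreover have "m mod k + 1 \<in> {1..k}" using assms(1) by (auto simp: Suc_leI)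
    ultimately have "?f (\<tau> (m div k * k + (m mod k + 1))) = \<sigma> (m div k + 1)"
      using f by blast
    moreover have "m div k * k + (m mod k + 1) = inv \<tau> x"
      using div_mult_mod_eq[of m k] m(2) by linarith
    ultimately show ?thesis using permutes_inverses(1)[OF assms(4)] by (simp add: m_def)
  qed
  moreover have "?f x = undefined" if "x \<notin> {1..n}" for x
    using conjunct1[OF f] that by (rule PiE_arb)
  ultimately show ?thesis by (intro ext) (simp only: restrict_apply split: if_split, blast)
qed

text \<open>The fibre over \<open>y\<close> is the image under \<open>\<tau>\<close> of the block of
  positions with index \<open>inv \<sigma> y - 1\<close>; this block has \<open>k\<close> elements
  if its index is below \<open>r\<close> and is empty otherwise.\<close>

lemma mapping_of_perms_zero_k:
  assumes "k \<ge> 2" "n = k * r" "\<sigma> permutes {1..n}" "\<tau> permutes {1..n}"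
  shows "mapping_of_perms k r n \<sigma> \<tau> \<in> zero_k_mappings k n"
proof -
  let ?f = "mapping_of_perms k r n \<sigma> \<tau>"
  have "?f \<in> {1..n} \<rightarrow>\<^sub>E {1..n}"
    using theI'[OF mapping_of_perms_ex1[OF assms]] unfolding mapping_of_perms_def by blast
  moreover have "card {x \<in> {1..n}. ?f x = y} \<in> {0, k}" if "y \<in> {1..n}" for y
  proof -
    have "inv \<sigma> y \<in> {1..n}"
      using permutes_in_image[OF permutes_inv[OF assms(3)]] that by blast
    then obtain c where c: "inv \<sigma> y = c + 1" "c < n"
      by (cases "inv \<sigma> y") auto
    have "{x \<in> {1..n}. ?f x = y} = {x \<in> {1..n}. \<sigma> ((inv \<tau> x - 1) div k + 1) = y}"
      by (auto simp: mapping_of_perms_eq[OF assms])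
    also have "\<dots> = {x \<in> {1..n}. (inv \<tau> x - 1) div k = c}"
    proof -
      have "\<sigma> (m + 1) = y \<longleftrightarrow> m = c" for m
        using permutes_inv_eq[OF assms(3), of y "m + 1"] c by auto
      then show ?thesis by simp
    qed
    also have "\<dots> = \<tau> ` {m \<in> {1..n}. (m - 1) div k = c}"
    proof safe
      fix x assume x: "x \<in> {1..n}" "c = (inv \<tau> x - 1) div k"
      then have "inv \<tau> x \<in> {1..n}"
        using permutes_in_image[OF permutes_inv[OF assms(4)]] by blast
      then show "x \<in> \<tau> ` {m \<in> {1..n}. (m - 1) div k = (inv \<tau> x - 1) div k}"
        by (intro image_eqI[of _ _ "inv \<tau> x"]) (auto simp: permutes_inverses(1)[OF assms(4)])
    next
      fix m assume "m \<in> {1..n}"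
      then show "\<tau> m \<in> {1..n}" using permutes_in_image[OF assms(4)] by blast
    qed (simp add: permutes_inverses(2)[OF assms(4)])
    finally have card: "card {x \<in> {1..n}. ?f x = y} = card {m \<in> {1..n}. (m - 1) div k = c}"
      by (simp add: card_image[OF permutes_inj_on[OF assms(4)]])
    have "{m \<in> {1..n}. (m - 1) div k = c} = (if c < r then {c * k + 1..c * k + k} else {})"
    proof -
      have "(m - 1) div k = c \<longleftrightarrow> m \<in> {c * k + 1..c * k + k}" if "m \<ge> 1" for m
      proof -
        have "c \<le> (m - 1) div k \<longleftrightarrow> c * k \<le> m - 1" "(m - 1) div k < Suc c \<longleftrightarrow> m - 1 < Suc c * k"
          using assms(1) less_eq_div_iff_mult_less_eq[of k c "m - 1"]
            div_less_iff_less_mult[of k "m - 1" "Suc c"] by linarith+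
        then have "(m - 1) div k = c \<longleftrightarrow> c * k \<le> m - 1 \<and> m - 1 < Suc c * k" by linarith
        moreover have "c * k \<le> m - 1 \<and> m - 1 < Suc c * k \<longleftrightarrow> m \<in> {c * k + 1..c * k + k}"
          using that by (cases m) auto
        ultimately show ?thesis by blast
      qed
      then have "m \<in> {1..n} \<and> (m - 1) div k = c \<longleftrightarrow> m \<in> {1..n} \<inter> {c * k + 1..c * k + k}" for m
        by (metis IntD1 IntD2 IntI atLeastAtMost_iff)
      then have eq: "{m \<in> {1..n}. (m - 1) div k = c} = {1..n} \<inter> {c * k + 1..c * k + k}"
        by blast
      have "{c * k + 1..c * k + k} \<subseteq> {1..n}" if "c < r"
        using mult_le_mono1[of "Suc c" r k] that assms(2) by (auto simp: mult.commute)
      moreover have "n \<le> c * k" if "\<not> c < r"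
        using mult_le_mono1[of r c k] that assms(2) by (simp add: mult.commute)
      ultimately show ?thesis unfolding eq by (cases "c < r") auto
    qed
    then show ?thesis unfolding card by simp
  qed
  ultimately show ?thesis by (simp add: zero_k_mappings_def)
qed

text \<open>In the closed formula \<open>\<tau>\<close> enters only through its inverse, and
  \<open>inv (inv p \<circ> \<tau>) = inv \<tau> \<circ> p\<close>; this explains the inverse on
  \<open>p\<close>.\<close>

lemma mapping_of_perms_relabel:
  assumes "k \<ge> 2" "n = k * r" "\<sigma> permutes {1..n}" "\<tau> permutes {1..n}"
    and a: "a permutes {1..n}" and p: "p permutes {1..n}"
  shows "mapping_of_perms k r n (a \<circ> \<sigma>) (inv p \<circ> \<tau>) =
         relabel {1..n} a p (mapping_of_perms k r n \<sigma> \<tau>)"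
proof -
  have "inv (inv p \<circ> \<tau>) = inv \<tau> \<circ> p"
    using o_inv_distrib[OF permutes_bij[OF permutes_inv[OF p]] permutes_bij[OF assms(4)]]
    by (simp add: permutes_inv_inv[OF p])
  moreover have "p x \<in> {1..n}" if "x \<in> {1..n}" for x
    using permutes_in_image[OF p] that by blast
  moreover note permutes_compose[OF assms(3) a] permutes_compose[OF assms(4) permutes_inv[OF p]]
  ultimately show ?thesis
    by (auto simp: mapping_of_perms_eq[OF assms(1,2)] assms(3,4) relabel_def
        simp del: atLeastAtMost_iff One_nat_def intro!: restrict_ext)
qed

section \<open>Invariance of the output distribution and uniformity\<close>

text \<open>Left multiplication by \<open>a\<close> is a bijection of the symmetric group, with
  inverse left multiplication by \<open>inv a\<close>.\<close>

lemma map_pmf_compose_permutations: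
  assumes "finite A" "a permutes A"
  shows "map_pmf ((\<circ>) a) (pmf_of_set {\<sigma>. \<sigma> permutes A}) = pmf_of_set {\<sigma>. \<sigma> permutes A}"
proof (rule map_pmf_of_set_bij_betw)
  show "bij_betw ((\<circ>) a) {\<sigma>. \<sigma> permutes A} {\<sigma>. \<sigma> permutes A}"
    by (rule bij_betw_byWitness[where f' = "(\<circ>) (inv a)"])
       (auto simp: permutes_compose permutes_inv assms(2) o_assoc permutes_inv_o[OF assms(2)])
  show "{\<sigma>. \<sigma> permutes A} \<noteq> {}" using permutes_id by blast
qed (rule finite_permutations[OF assms(1)])

lemma random_mapping_invariant:
  assumes "k \<ge> 2" "n = k * r" and a: "a permutes {1..n}" and p: "p permutes {1..n}"
  shows "map_pmf (relabel {1..n} a p) (random_mapping k r n) = random_mapping k r n"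
proof -
  let ?U = "pmf_of_set {\<sigma>. \<sigma> permutes {1..n}}"
  let ?M = "\<lambda>(\<sigma>, \<tau>). mapping_of_perms k r n \<sigma> \<tau>"
  have ne: "{\<sigma>. \<sigma> permutes {1..n}} \<noteq> {}" using permutes_id by blast
  have set: "set_pmf ?U = {\<sigma>. \<sigma> permutes {1..n}}"
    by (intro set_pmf_of_set ne finite_permutations) simp
  have "random_mapping k r n
      = map_pmf ?M (pair_pmf (map_pmf ((\<circ>) a) ?U) (map_pmf ((\<circ>) (inv p)) ?U))"
    by (simp only: random_mapping_def map_pmf_compose_permutations[OF _ a]
        map_pmf_compose_permutations[OF _ permutes_inv[OF p]] finite_atLeastAtMost)
  also have "\<dots> = map_pmf (\<lambda>(\<sigma>, \<tau>). mapping_of_perms k r n (a \<circ> \<sigma>) (inv p \<circ> \<tau>)) (pair_pmf ?U ?U)"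
    by (simp add: map_pair[symmetric] pmf.map_comp comp_def case_prod_unfold)
  \<comment> \<open>The two maps need to agree only on the support, where both components are
    permutations.\<close>
  also have "\<dots> = map_pmf (relabel {1..n} a p \<circ> ?M) (pair_pmf ?U ?U)"
    by (intro map_pmf_cong refl)
       (auto simp: set mapping_of_perms_relabel[OF assms(1,2) _ _ a p] simp del: One_nat_def)
  finally show ?thesis unfolding random_mapping_def pmf.map_comp by (rule sym)
qed

lemma pmf_eq_pmf_of_set:
  assumes "set_pmf p = A" "finite A" "\<And>x y. x \<in> A \<Longrightarrow> y \<in> A \<Longrightarrow> pmf p x = pmf p y"
  shows "p = pmf_of_set A"
proof -
  have ne: "A \<noteq> {}" using assms(1) set_pmf_not_empty[of p] by simp
  have "pmf p x = 1 / card A" if "x \<in> A" for x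
  proof -
    have "1 = sum (pmf p) A" using sum_pmf_eq_1[of A p] assms(1,2) by simp
    also have "\<dots> = (\<Sum>y\<in>A. pmf p x)" by (intro sum.cong refl assms(3) that)
    finally show ?thesis using ne assms(2) by (simp add: field_simps)
  qed
  moreover have "pmf p x = 0" if "x \<notin> A" for x
    by (simp add: pmf_eq_0_set_pmf assms(1) that)
  ultimately show ?thesis
    using ne assms(2) by (intro pmf_eqI) (simp add: indicator_def)
qed

theorem theorem6p1:
  fixes r k n :: nat
  assumes "r \<ge> 1" and "k \<ge> 2" and "n = k * r"
  shows "random_mapping k r n = pmf_of_set (zero_k_mappings k n)"
proof -
  let ?R = "random_mapping k r n" and ?Z = "zero_k_mappings k n"
  have "{\<sigma>. \<sigma> permutes {1..n}} \<noteq> {}" using permutes_id by blast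
  then have sub: "set_pmf ?R \<subseteq> ?Z"
    using mapping_of_perms_zero_k[OF assms(2,3)]
    by (auto simp: random_mapping_def finite_permutations simp del: One_nat_def)
  \<comment> \<open>Besides equal probabilities this yields positivity at \<open>g\<close>, so one
    point of the support forces the support to be all of \<open>?Z\<close>.\<close>
  have orbit: "g \<in> set_pmf ?R \<and> pmf ?R g = pmf ?R f" if fg: "f \<in> set_pmf ?R" "g \<in> ?Z" for f g
  proof -
    obtain a p where a: "a permutes {1..n}" and p: "p permutes {1..n}"
      and g: "g = relabel {1..n} a p f"
    proof (rule zero_k_mappings_transitive)
      show "k > 0" using assms(2) by simp
      show "f \<in> ?Z" "g \<in> ?Z" using fg sub by auto
    qed
    note inv = random_mapping_invariant[OF assms(2,3) a p]
    have "inj_on (relabel {1..n} a p) (set_pmf ?R)"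
      using sub zero_k_mappings_PiE
      by (intro inj_on_subset[OF relabel_inj_on[OF permutes_inj[OF a] p]]) blast
    \<comment> \<open>Injectivity gives \<open>g\<close> under the relabelled distribution the mass
      that \<open>f\<close> has under \<open>?R\<close>; by invariance the relabelled distribution
      is \<open>?R\<close> itself.\<close>
    from pmf_map_inj[OF this fg(1)] have "pmf ?R g = pmf ?R f" by (simp only: inv g)
    then show ?thesis using fg(1) by (simp add: set_pmf_iff)
  qed
  obtain f where "f \<in> set_pmf ?R" using set_pmf_not_empty by fast
  with sub orbit have eq: "set_pmf ?R = ?Z" by blast
  show ?thesis
  proof (rule pmf_eq_pmf_of_set[OF eq finite_zero_k_mappings])
    show "pmf ?R f = pmf ?R g" if "f \<in> ?Z" "g \<in> ?Z" for f g
      using orbit[of g f] that eq by blast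
  qed
qed

end
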